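(* Let $1\leq p_{1}\leq p_{2}<2p_{1}$ be real numbers, let $C>0$ be a constant, and let $Z_1,Z_2,V,W_1,W_2,R_1,R_2,S$ be as described in the context. Assume that $$\left(\sup_{v\in V}\sum_{i=1}^{m_{1}}\sum_{j=1}^{m_{2}}S(z_{1,i},z_{2,j},v)^{p_{1}}\right)^{\frac{1}{p_{1}}}\leq C\left(\sup_{w\in W_{1}}\sum_{i=1}^{m_{1}}R_{1}(z_{1,i},w)^{p_{1}}\right)^{\frac{1}{p_{1}}}\left(\sup_{w\in W_{2}}\sum_{j=1}^{m_{2}}R_{2}(z_{2,j},w)^{p_{1}}\right)^{\frac{1}{p_{1}}}$$ for all $m_1,m_2\in\mathbb{N}$ and all $z_{1,i}\in Z_1$ ($i=1,\dots,m_1$), $z_{2,j}\in Z_2$ ($j=1,\dots,m_2$). Then $$\left(\sup_{v\in V}\sum_{i=1}^{m_{1}}\sum_{j=1}^{m_{2}}S(z_{1,i},z_{2,j},v)^{\frac{p_{1}p_{2}}{2p_{1}-p_{2}}}\right)^{\frac{2p_{1}-p_{2}}{p_{1}p_{2}}}\leq C\left(\sup_{w\in W_{1}}\sum_{i=1}^{m_{1}}R_{1}(z_{1,i},w)^{p_{2}}\right)^{\frac{1}{p_{2}}}\left(\sup_{w\in W_{2}}\sum_{j=1}^{m_{2}}R_{2}(z_{2,j},w)^{p_{2}}\right)^{\frac{1}{p_{2}}}$$ for all $m_1,m_2\in\mathbb{N}$ and all $z_{1,i}\in Z_1$ ($i=1,\dots,m_1$), $z_{2,j}\in Z_2$ 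($j=1,\dots,m_2$).
   Context: $Z_1$, $V$, $W_1$, $W_2$ are arbitrary non-empty sets and $Z_2$ is a vector space (over the real or complex numbers). The maps $R_t\colon Z_t\times W_t\to[0,\infty)$ ($t=1,2$) and $S\colon Z_1\times Z_2\times V\to[0,\infty)$ are arbitrary mappings satisfying $R_2(\lambda z,w)=\lambda R_2(z,w)$ and $S(z_1,\lambda z_2,v)=\lambda S(z_1,z_2,v)$ for all real scalars $\lambda\geq 0$ and all arguments. It is a standing assumption that $\left(\sup_{w\in W_t}\sum_{j=1}^{m_t}R_t(z_{t,j},w)^{p_1}\right)^{1/p_1}<\infty$ for $t=1,2$, for all finite families $z_{t,1},\dots,z_{t,m_t}\in Z_t$. *)

theory Defs
  imports "HOL-Analysis.Analysis"
begin

text \<open>Powers with real exponent on the extended half-line, so that a possibly infinite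
  supremum may be raised to a power; only used for positive exponents, where it is the usual
  extension with \<open>\<infinity>\<close> raised to the exponent equal to \<open>\<infinity>\<close>.\<close>

definition ennpowr :: "ennreal \<Rightarrow> real \<Rightarrow> ennreal" (infixr "epowr" 80) where
  "x epowr a = (if x = \<infinity> then \<infinity> else ennreal (enn2real x powr a))"

lemma ennpowr_top [simp]: "\<infinity> epowr a = \<infinity>"
  by (simp add: ennpowr_def)

lemma ennpowr_ennreal: "0 \<le> x \<Longrightarrow> ennreal x epowr a = ennreal (x powr a)"
  by (simp add: ennpowr_def)

end

theory Submission
  imports Defs
begin

text \<open>Repeating points of \<open>Z1\<close> and rescaling points of \<open>Z2\<close> turns the hypothesis into the same
  inequality with arbitrary nonnegative real weights on both families. Put \<open>t = 1 - p1 / p2\<close> and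
  \<open>s i j = S (z1 i) (z2 j) v powr p1\<close>. By Hoelder's inequality the weighted hypothesis says that the
  bilinear form with matrix \<open>s\<close> is bounded on \<open>\<ell>\<^sup>\<rho> \<times> \<ell>\<^sup>\<rho>\<close> with \<open>1 / \<rho> = t < 1/2\<close>. For such a form
  with nonnegative entries, the norm of the entries in \<open>\<ell>\<^sup>q\<close>, \<open>1 / q = 1 - 2 * t\<close>, is at most the norm
  of the form, which is the conclusion.\<close>

section \<open>Superadditivity of powers and Hoelder's inequality\<close>

text \<open>Each \<open>f i\<close> is at most the total, so in
  \<open>f i powr p = f i * f i powr (p - 1)\<close> the second factor may be replaced by that power
  of the total.\<close>

lemma sum_powr_le_powr_sum:
  fixes f :: "'a \<Rightarrow> real"
  assumes f: "\<And>i. i \<in> I \<Longrightarrow> 0 \<le> f i" and p: "1 \<le> p"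
  shows "(\<Sum>i\<in>I. f i powr p) \<le> (\<Sum>i\<in>I. f i) powr p"
proof (cases "finite I")
  case True
  let ?S = "\<Sum>i\<in>I. f i"
  have split: "x powr p = x * x powr (p - 1)" if "0 \<le> x" for x :: real
    using that powr_add[of x 1 "p - 1"] by simp
  have "(\<Sum>i\<in>I. f i powr p) \<le> (\<Sum>i\<in>I. f i * ?S powr (p - 1))"
  proof (rule sum_mono)
    fix i assume "i \<in> I"
    then have "f i \<le> ?S" using f True by (intro member_le_sum) auto
    then show "f i powr p \<le> f i * ?S powr (p - 1)"
      using \<open>i \<in> I\<close> f p by (auto simp: split intro!: mult_left_mono powr_mono2)
  qed
  also have "\<dots> = ?S powr p"
    using f by (simp add: split sum_nonneg sum_distrib_right)
  finally show ?thesis .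
qed simp

text \<open>Young's inequality is applied to the terms divided by their totals; the weights then sum
  to \<open>a + b = 1\<close>.\<close>

lemma Holder_sum:
  fixes f g :: "'a \<Rightarrow> real"
  assumes f: "\<And>i. i \<in> I \<Longrightarrow> 0 \<le> f i" and g: "\<And>i. i \<in> I \<Longrightarrow> 0 \<le> g i"
    and ab: "0 \<le> a" "0 \<le> b" "a + b = 1"
  shows "(\<Sum>i\<in>I. f i powr a * g i powr b) \<le> (\<Sum>i\<in>I. f i) powr a * (\<Sum>i\<in>I. g i) powr b"
proof (cases "finite I \<and> 0 < sum f I \<and> 0 < sum g I")
  case True
  let ?F = "sum f I" and ?G = "sum g I"
  have "f i powr a * g i powr b \<le> ?F powr a * ?G powr b * (a * (f i / ?F) + b * (g i / ?G))"
    if "i \<in> I" for i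
  proof -
    have "(f i / ?F) powr a * (g i / ?G) powr b \<le> a * (f i / ?F) + b * (g i / ?G)"
    proof (cases "f i = 0 \<or> g i = 0")
      case False
      then show ?thesis
        using True f[OF that] g[OF that] ab by (intro Youngs_inequality_0) auto
    qed (use True f[OF that] g[OF that] ab in auto)
    then show ?thesis
      using True f[OF that] g[OF that] by (simp add: powr_divide field_simps)
  qed
  then have "(\<Sum>i\<in>I. f i powr a * g i powr b)
      \<le> (\<Sum>i\<in>I. ?F powr a * ?G powr b * (a * (f i / ?F) + b * (g i / ?G)))"
    by (rule sum_mono)
  also have "\<dots> = ?F powr a * ?G powr b * (a * (?F / ?F) + b * (?G / ?G))"
    unfolding sum_distrib_left[symmetric] sum.distrib sum_divide_distrib[symmetric] ..
  also have "\<dots> = ?F powr a * ?G powr b"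
    using True ab by simp
  finally show ?thesis .
next
  case False
  \<comment> \<open>Since \<open>0 powr a = 0\<close> even for \<open>a = 0\<close>, a vanishing
    factor kills the term at every exponent.\<close>
  have "f i powr a * g i powr b = 0" if "finite I" "i \<in> I" for i
  proof -
    have "sum f I = 0 \<or> sum g I = 0"
      using False that sum_nonneg[of I f] sum_nonneg[of I g] f g by force
    then have "f i = 0 \<or> g i = 0"
      using that f g by (auto simp: sum_nonneg_eq_0_iff)
    then show ?thesis by auto
  qed
  then have "(\<Sum>i\<in>I. f i powr a * g i powr b) = 0"
    by (cases "finite I") (auto intro: sum.neutral)
  then show ?thesis by simp
qed

section \<open>Entrywise norms of nonnegative bilinear forms\<close>

text \<open>The test vectors are the extremals of two successive dualities: with \<open>1 / r = 1 - t\<close>, the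
  vector \<open>a\<close> norms \<open>y = s b\<close> in \<open>\<ell>\<^sup>r\<close>, and superadditivity of \<open>x powr r\<close> reduces the rest to the
  numbers \<open>T j\<close>, which \<open>b\<close> norms in \<open>\<ell>\<^sup>e\<close>.\<close>

lemma positive_bilinear_form_Hardy_Littlewood:
  fixes s :: "'a \<Rightarrow> 'b \<Rightarrow> real" and t D :: real
  assumes fin: "finite I" "finite J"
    and s: "\<And>i j. i \<in> I \<Longrightarrow> j \<in> J \<Longrightarrow> 0 \<le> s i j"
    and t: "0 \<le> t" "t < 1/2" and D: "0 \<le> D"
    and bound: "\<And>a b. (\<And>i. i \<in> I \<Longrightarrow> 0 \<le> a i) \<Longrightarrow> (\<And>j. j \<in> J \<Longrightarrow> 0 \<le> b j) \<Longrightarrow>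
      (\<Sum>i\<in>I. \<Sum>j\<in>J. a i powr t * b j powr t * s i j) \<le> D * sum a I powr t * sum b J powr t"
  shows "(\<Sum>i\<in>I. \<Sum>j\<in>J. s i j powr (1 / (1 - 2 * t))) \<le> D powr (1 / (1 - 2 * t))"
proof -
  define r where "r = 1 / (1 - t)"
  \<comment> \<open>This \<open>e\<close> solves \<open>e = 1 + e * (r - 1)\<close>, so that
    \<open>T j * (b j powr t) powr r\<close> is \<open>b j\<close> again; \<open>t < 1/2\<close>
    means \<open>r < 2\<close> and keeps \<open>e\<close> positive.\<close>
  define e where "e = 1 / (2 - r)"
  have r: "1 \<le> r" "r < 2" "r * t = r - 1"
    using t by (auto simp: r_def field_simps)
  have e: "1 \<le> e" using r by (simp add: e_def)
  have re: "r * e = 1 / (1 - 2 * t)"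
    using t by (auto simp: r_def e_def field_simps)
  have er: "1 + e * (r - 1) = e"
    using r by (simp add: e_def field_simps)
  define T where "T j = (\<Sum>i\<in>I. s i j powr r)" for j
  define b where "b j = T j powr e" for j
  define y where "y i = (\<Sum>j\<in>J. s i j * b j powr t)" for i
  define Y where "Y = (\<Sum>i\<in>I. y i powr r)"
  have T: "0 \<le> T j" for j by (simp add: T_def sum_nonneg)
  have b: "0 \<le> b j" for j by (simp add: b_def)
  have y: "0 \<le> y i" if "i \<in> I" for i using s that by (auto simp: y_def intro!: sum_nonneg)
  have Y: "0 \<le> Y" by (simp add: Y_def sum_nonneg)
  \<comment> \<open>With \<open>a i = y i powr r\<close> and \<open>r * t = r - 1\<close>, the form
    at \<open>(a, b)\<close> is exactly \<open>Y\<close>.\<close>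
  have "Y = (\<Sum>i\<in>I. \<Sum>j\<in>J. (y i powr r) powr t * b j powr t * s i j)"
    unfolding Y_def
  proof (rule sum.cong[OF refl])
    fix i assume "i \<in> I"
    have "(y i powr r) powr t = y i powr (r - 1)"
      by (simp add: powr_powr r(3))
    then have "y i powr r = (y i powr r) powr t * y i"
      using y[OF \<open>i \<in> I\<close>] powr_add[of "y i" "r - 1" 1] by simp
    also have "\<dots> = (\<Sum>j\<in>J. (y i powr r) powr t * b j powr t * s i j)"
      by (subst (2) y_def) (simp add: sum_distrib_left mult_ac)
    finally show "y i powr r = (\<Sum>j\<in>J. (y i powr r) powr t * b j powr t * s i j)" .
  qed
  also have "\<dots> \<le> D * Y powr t * sum b J powr t"
    unfolding Y_def using b by (intro bound) auto
  finally have upper: "Y \<le> D * Y powr t * sum b J powr t" .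
  have "sum b J = (\<Sum>j\<in>J. \<Sum>i\<in>I. (s i j * b j powr t) powr r)"
  proof (rule sum.cong[OF refl])
    fix j assume "j \<in> J"
    have "T j powr e = T j * T j powr (e * (r - 1))"
      using T[of j] powr_add[of "T j" 1 "e * (r - 1)"] er by simp
    also have "T j powr (e * (r - 1)) = (b j powr t) powr r"
      using r by (simp add: b_def powr_powr mult_ac)
    also have "T j * (b j powr t) powr r = (\<Sum>i\<in>I. (s i j * b j powr t) powr r)"
      unfolding T_def sum_distrib_right using s \<open>j \<in> J\<close> by (simp add: powr_mult)
    finally show "b j = (\<Sum>i\<in>I. (s i j * b j powr t) powr r)"
      by (simp only: b_def)
  qed
  also have "\<dots> = (\<Sum>i\<in>I. \<Sum>j\<in>J. (s i j * b j powr t) powr r)"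
    by (rule sum.swap)
  also have "\<dots> \<le> Y"
    unfolding Y_def y_def using s r by (intro sum_mono sum_powr_le_powr_sum) auto
  finally have lower: "sum b J \<le> Y" .
  \<comment> \<open>Cancelling \<open>Y powr t\<close> in \<open>upper\<close> and inserting
    \<open>lower\<close> leaves an inequality in \<open>sum b J\<close> alone, with exponent
    \<open>1 - 2 * t\<close>.\<close>
  have b_le: "sum b J \<le> D powr (1 / (1 - 2 * t))"
  proof (cases "sum b J = 0")
    case False
    then have pos: "0 < sum b J" "0 < Y"
      using lower sum_nonneg[of J b] b by force+
    have "Y powr (1 - t) * Y powr t = Y"
      using pos by (simp flip: powr_add)
    with upper pos have "Y powr (1 - t) * Y powr t \<le> (D * sum b J powr t) * Y powr t"
      by (simp add: mult_ac)
    then have "Y powr (1 - t) \<le> D * sum b J powr t"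
      using pos by (simp add: mult_le_cancel_right)
    moreover have "sum b J powr (1 - t) \<le> Y powr (1 - t)"
      using lower pos t by (intro powr_mono2) auto
    moreover have "sum b J powr (1 - t) = sum b J powr (1 - 2 * t) * sum b J powr t"
      by (simp flip: powr_add)
    ultimately have "sum b J powr (1 - 2 * t) * sum b J powr t \<le> D * sum b J powr t"
      by linarith
    then have "sum b J powr (1 - 2 * t) \<le> D"
      using pos by (simp add: mult_le_cancel_right)
    then have "(sum b J powr (1 - 2 * t)) powr (1 / (1 - 2 * t)) \<le> D powr (1 / (1 - 2 * t))"
      using t by (intro powr_mono2) auto
    then show ?thesis using t pos by (simp add: powr_powr)
  qed simp
  have "(\<Sum>i\<in>I. \<Sum>j\<in>J. s i j powr (1 / (1 - 2 * t)))
      = (\<Sum>j\<in>J. \<Sum>i\<in>I. (s i j powr r) powr e)"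
    by (subst sum.swap) (simp add: powr_powr re)
  also have "\<dots> \<le> sum b J"
    unfolding b_def T_def using e by (intro sum_mono sum_powr_le_powr_sum) auto
  finally show ?thesis using b_le by linarith
qed

section \<open>From unweighted to weighted inequalities\<close>

text \<open>Each \<open>z i\<close> is listed \<open>n i\<close> times. The family does not depend
  on \<open>f\<close>, so it can serve both sides of an inequality and all parameters
  \<open>w\<close> at once.\<close>

lemma ex_repeated_family:
  fixes z :: "nat \<Rightarrow> 'a" and n :: "nat \<Rightarrow> nat"
  shows "\<exists>(k::nat) z'. (\<forall>i\<in>{1..k}. z' i \<in> z ` {1..m}) \<and>
    (\<forall>f :: 'a \<Rightarrow> real. (\<Sum>i=1..k. f (z' i)) = (\<Sum>i=1..m. of_nat (n i) * f (z i)))"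
proof -
  define xs where "xs = concat (map (\<lambda>i. replicate (n i) (z i)) [1..<Suc m])"
  \<comment> \<open>Lists count from 0, families from 1.\<close>
  define z' where "z' i = xs ! (i - 1)" for i
  show ?thesis
  proof (intro exI conjI ballI allI)
    fix i assume "i \<in> {1..length xs}"
    then have "z' i \<in> set xs" by (auto simp: z'_def)
    also have "set xs \<subseteq> z ` {1..m}" by (auto simp: xs_def simp del: upt_Suc)
    finally show "z' i \<in> z ` {1..m}" .
  next
    fix f :: "'a \<Rightarrow> real"
    have "(\<Sum>i=1..length xs. f (z' i)) = (\<Sum>i<length xs. f (xs ! i))"
      unfolding z'_def by (rule sum.reindex_bij_witness[of _ Suc "\<lambda>i. i - 1"]) auto
    also have "\<dots> = sum_list (map f xs)"
      by (simp add: sum_list_sum_nth atLeast0LessThan)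
    also have "\<dots> = (\<Sum>i=1..m. of_nat (n i) * f (z i))"
      unfolding xs_def by (induction m) (auto simp: sum_list_replicate)
    finally show "(\<Sum>i=1..length xs. f (z' i)) = (\<Sum>i=1..m. of_nat (n i) * f (z i))" .
  qed
qed

text \<open>Archimedean argument: an error \<open>c\<close> independent of \<open>N\<close>
  disappears after division by \<open>N\<close>. It removes the rounding error below.\<close>

lemma le_if_all_nat_multiples_le:
  fixes x y c :: real
  assumes "\<And>N::nat. real N * x \<le> real N * y + c"
  shows "x \<le> y"
proof (rule ccontr)
  assume "\<not> x \<le> y"
  then obtain N :: nat where "c < real N * (x - y)"
    using ex_less_of_nat_mult[of "x - y" c] by auto
  with assms[of N] show False by (simp add: algebra_simps)
qed

text \<open>Natural weights arise by repeating points; real ones are approximated by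
  \<open>\<lceil>N a\<rceil> / N\<close>, the rounding error being controlled by the uniform bound \<open>B\<close>.\<close>

lemma weighted_bound:
  fixes f :: "'z \<Rightarrow> 'w \<Rightarrow> real" and g :: "'z \<Rightarrow> real"
  assumes unweighted: "\<And>k z M. (\<And>i. i \<in> {1..k::nat} \<Longrightarrow> z i \<in> Z) \<Longrightarrow>
        (\<And>w. w \<in> W \<Longrightarrow> (\<Sum>i=1..k. f (z i) w) \<le> M) \<Longrightarrow> 0 \<le> M \<Longrightarrow> (\<Sum>i=1..k. g (z i)) \<le> K * M"
    and z: "\<And>i. i \<in> {1..m::nat} \<Longrightarrow> z i \<in> Z"
    and a: "\<And>i. i \<in> {1..m} \<Longrightarrow> 0 \<le> a i"
    and f: "\<And>x w. x \<in> Z \<Longrightarrow> w \<in> W \<Longrightarrow> 0 \<le> f x w" and g: "\<And>x. x \<in> Z \<Longrightarrow> 0 \<le> g x"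
    and B: "\<And>w. w \<in> W \<Longrightarrow> (\<Sum>i=1..m. f (z i) w) \<le> B" "0 \<le> B"
    and M: "\<And>w. w \<in> W \<Longrightarrow> (\<Sum>i=1..m. a i * f (z i) w) \<le> M" "0 \<le> M"
  shows "(\<Sum>i=1..m. a i * g (z i)) \<le> K * M"
proof (rule le_if_all_nat_multiples_le)
  fix N :: nat
  \<comment> \<open>Rounding up never shrinks the sum over \<open>g\<close>, while the sums over
    \<open>f\<close> gain at most one extra copy of the family, bounded by \<open>B\<close> whatever
    \<open>N\<close> is.\<close>
  define n where "n i = nat \<lceil>real N * a i\<rceil>" for i
  have n: "real N * a i \<le> n i" "n i \<le> real N * a i + 1" if i: "i \<in> {1..m}" for i
  proof -
    have "real (n i) = of_int \<lceil>real N * a i\<rceil>"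
    proof -
      have "0 \<le> real N * a i" using a[OF i] by simp
      then have "0 \<le> \<lceil>real N * a i\<rceil>" by linarith
      then show ?thesis by (simp add: n_def)
    qed
    then show "real N * a i \<le> n i" "n i \<le> real N * a i + 1" by linarith+
  qed
  obtain k :: nat and z' where rep: "(\<forall>i\<in>{1..k}. z' i \<in> z ` {1..m}) \<and>
      (\<forall>h :: 'z \<Rightarrow> real. (\<Sum>i=1..k. h (z' i)) = (\<Sum>i=1..m. of_nat (n i) * h (z i)))"
    using ex_repeated_family[where z = z and m = m and n = n] by (elim exE)
  then have z': "\<And>i. i \<in> {1..k} \<Longrightarrow> z' i \<in> z ` {1..m}"
    and sum_z': "\<And>h :: 'z \<Rightarrow> real. (\<Sum>i=1..k. h (z' i)) = (\<Sum>i=1..m. of_nat (n i) * h (z i))"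
    by (blast, simp only:)
  have "real N * (\<Sum>i=1..m. a i * g (z i)) \<le> (\<Sum>i=1..m. n i * g (z i))"
    unfolding sum_distrib_left mult.assoc[symmetric]
    using n g z by (intro sum_mono mult_right_mono) auto
  also have "\<dots> = (\<Sum>i=1..k. g (z' i))" by (simp only: sum_z')
  also have "\<dots> \<le> K * (real N * M + B)"
  proof (rule unweighted)
    show "z' i \<in> Z" if "i \<in> {1..k}" for i using z'[OF that] z by auto
    fix w assume w: "w \<in> W"
    have "(\<Sum>i=1..k. f (z' i) w) = (\<Sum>i=1..m. n i * f (z i) w)" by (rule sum_z')
    also have "\<dots> \<le> (\<Sum>i=1..m. (real N * a i + 1) * f (z i) w)"
      using n f z w by (intro sum_mono mult_right_mono) auto
    also have "\<dots> = real N * (\<Sum>i=1..m. a i * f (z i) w) + (\<Sum>i=1..m. f (z i) w)"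
      by (simp add: distrib_right sum.distrib sum_distrib_left mult.assoc)
    also have "\<dots> \<le> real N * M + B"
      using M(1)[OF w] B(1)[OF w] by (intro add_mono mult_left_mono) auto
    finally show "(\<Sum>i=1..k. f (z' i) w) \<le> real N * M + B" .
  qed (use B M in auto)
  finally show "real N * (\<Sum>i=1..m. a i * g (z i)) \<le> real N * (K * M) + K * B"
    by (simp add: algebra_simps)
qed

section \<open>Finite suprema and weighted Hoelder bounds\<close>

lemma SUP_ennreal_finite_bound:
  fixes f :: "'a \<Rightarrow> real"
  assumes "(SUP x\<in>A. ennreal (f x)) < \<infinity>"
  obtains M where "0 \<le> M" "(SUP x\<in>A. ennreal (f x)) = ennreal M" "\<And>x. x \<in> A \<Longrightarrow> f x \<le> M"
proof -
  obtain M where M: "0 \<le> M" "(SUP x\<in>A. ennreal (f x)) = ennreal M"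
    using assms by (cases "SUP x\<in>A. ennreal (f x)") auto
  moreover have "f x \<le> M" if "x \<in> A" for x
    using SUP_upper[OF that, of "\<lambda>x. ennreal (f x)"] M by (simp add: ennreal_le_iff)
  ultimately show thesis by (rule that)
qed

lemma epowr_mono:
  assumes "x \<le> y" "0 \<le> a"
  shows "x epowr a \<le> y epowr a"
  using assms
  by (auto simp: ennpowr_def top_unique less_top intro!: ennreal_leI powr_mono2 enn2real_mono)

lemma epowr_less_top_iff: "x epowr a < \<infinity> \<longleftrightarrow> x < \<infinity>"
  by (auto simp: ennpowr_def less_top)

text \<open>Superadditivity of \<open>x powr (q / p)\<close> bounds the \<open>q\<close>-sums by a
  power of the \<open>p\<close>-sums. This carries the standing finiteness assumption from
  \<open>p1\<close> to \<open>p2\<close>.\<close>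

lemma SUP_sum_powr_finite_mono:
  fixes f :: "'a \<Rightarrow> 'w \<Rightarrow> real"
  assumes "0 < p" "p \<le> q"
    and fin: "(SUP w\<in>W. ennreal (\<Sum>i\<in>I. f i w powr p)) < \<infinity>"
  shows "(SUP w\<in>W. ennreal (\<Sum>i\<in>I. f i w powr q)) < \<infinity>"
proof -
  obtain M where M: "0 \<le> M" "\<And>w. w \<in> W \<Longrightarrow> (\<Sum>i\<in>I. f i w powr p) \<le> M"
    using fin by (rule SUP_ennreal_finite_bound) blast
  have "(\<Sum>i\<in>I. f i w powr q) \<le> M powr (q / p)" if "w \<in> W" for w
  proof -
    have "(\<Sum>i\<in>I. f i w powr q) = (\<Sum>i\<in>I. (f i w powr p) powr (q / p))"
      using assms by (simp add: powr_powr)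
    also have "\<dots> \<le> (\<Sum>i\<in>I. f i w powr p) powr (q / p)"
      using assms by (intro sum_powr_le_powr_sum) auto
    also have "\<dots> \<le> M powr (q / p)"
      using assms(1,2) M(2)[OF that] by (intro powr_mono2 sum_nonneg) auto
    finally show ?thesis .
  qed
  then have "(SUP w\<in>W. ennreal (\<Sum>i\<in>I. f i w powr q)) \<le> ennreal (M powr (q / p))"
    by (intro SUP_least ennreal_leI) auto
  also have "\<dots> < \<infinity>" by simp
  finally show ?thesis .
qed

text \<open>Hoelder with exponents \<open>1 - p / q\<close> and \<open>p / q\<close>, after writing
  \<open>f i powr p\<close> as \<open>(f i powr q) powr (p / q)\<close>. It converts bounds at
  \<open>p2\<close> into weighted bounds at \<open>p1\<close>.\<close>

lemma Holder_sum_weights: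
  fixes a f :: "'a \<Rightarrow> real"
  assumes a: "\<And>i. i \<in> I \<Longrightarrow> 0 \<le> a i" and N: "(\<Sum>i\<in>I. f i powr q) \<le> N"
    and pq: "0 < p" "p \<le> q"
  shows "(\<Sum>i\<in>I. a i powr (1 - p / q) * f i powr p) \<le> sum a I powr (1 - p / q) * N powr (p / q)"
proof -
  have "(\<Sum>i\<in>I. a i powr (1 - p / q) * f i powr p)
      = (\<Sum>i\<in>I. a i powr (1 - p / q) * (f i powr q) powr (p / q))"
    using pq by (simp add: powr_powr)
  also have "\<dots> \<le> sum a I powr (1 - p / q) * (\<Sum>i\<in>I. f i powr q) powr (p / q)"
    using pq a N by (intro Holder_sum) auto
  also have "\<dots> \<le> sum a I powr (1 - p / q) * N powr (p / q)"
    using pq a N by (intro mult_left_mono powr_mono2 sum_nonneg) auto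
  finally show ?thesis .
qed

section \<open>Passage from exponent \<open>p1\<close> to exponent \<open>p2\<close>\<close>

theorem theorem2p1:
  fixes p1 p2 C :: real
    and Z1 :: "'z1 set" and V :: "'v set" and W1 :: "'w1 set" and W2 :: "'w2 set"
    \<comment> \<open>\<open>Z2\<close> is the vector space with underlying type \<open>'z2\<close>; the class \<open>real_normed_field\<close>
        covers exactly the scalar fields \<open>\<real>\<close> and \<open>\<complex>\<close>, up to isomorphism.\<close>
    and scale :: "'k::real_normed_field \<Rightarrow> 'z2::ab_group_add \<Rightarrow> 'z2"
    and R1 :: "'z1 \<Rightarrow> 'w1 \<Rightarrow> real"
    and R2 :: "'z2 \<Rightarrow> 'w2 \<Rightarrow> real"
    and S :: "'z1 \<Rightarrow> 'z2 \<Rightarrow> 'v \<Rightarrow> real"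
  assumes p: "1 \<le> p1" "p1 \<le> p2" "p2 < 2 * p1"
    and C: "C > 0"
    and nonempty: "Z1 \<noteq> {}" "V \<noteq> {}" "W1 \<noteq> {}" "W2 \<noteq> {}"
    and vector_space: "vector_space scale"
    and R1_nonneg: "\<And>z w. z \<in> Z1 \<Longrightarrow> w \<in> W1 \<Longrightarrow> 0 \<le> R1 z w"
    and R2_nonneg: "\<And>z w. w \<in> W2 \<Longrightarrow> 0 \<le> R2 z w"
    and S_nonneg: "\<And>z1 z2 v. z1 \<in> Z1 \<Longrightarrow> v \<in> V \<Longrightarrow> 0 \<le> S z1 z2 v"
    and R2_homogeneous: "\<And>(l::real) z w. 0 \<le> l \<Longrightarrow> w \<in> W2 \<Longrightarrow>
           R2 (scale (of_real l) z) w = l * R2 z w"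
    and S_homogeneous: "\<And>(l::real) z1 z2 v. 0 \<le> l \<Longrightarrow> z1 \<in> Z1 \<Longrightarrow> v \<in> V \<Longrightarrow>
           S z1 (scale (of_real l) z2) v = l * S z1 z2 v"
    and R1_finite: "\<And>(m::nat) z1. (\<And>i. i \<in> {1..m} \<Longrightarrow> z1 i \<in> Z1) \<Longrightarrow>
           (SUP w\<in>W1. ennreal (\<Sum>i=1..m. R1 (z1 i) w powr p1)) epowr (1 / p1) < \<infinity>"
    and R2_finite: "\<And>(m::nat) z2.
           (SUP w\<in>W2. ennreal (\<Sum>j=1..m. R2 (z2 j) w powr p1)) epowr (1 / p1) < \<infinity>"
    and summing: "\<And>(m1::nat) (m2::nat) z1 z2. (\<And>i. i \<in> {1..m1} \<Longrightarrow> z1 i \<in> Z1) \<Longrightarrow>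
           (SUP v\<in>V. ennreal (\<Sum>i=1..m1. \<Sum>j=1..m2. S (z1 i) (z2 j) v powr p1)) epowr (1 / p1)
           \<le> ennreal C
             * (SUP w\<in>W1. ennreal (\<Sum>i=1..m1. R1 (z1 i) w powr p1)) epowr (1 / p1)
             * (SUP w\<in>W2. ennreal (\<Sum>j=1..m2. R2 (z2 j) w powr p1)) epowr (1 / p1)"
  shows "\<forall>(m1::nat) (m2::nat) z1 z2. (\<forall>i\<in>{1..m1}. z1 i \<in> Z1) \<longrightarrow>
           (SUP v\<in>V. ennreal (\<Sum>i=1..m1. \<Sum>j=1..m2.
                S (z1 i) (z2 j) v powr (p1 * p2 / (2 * p1 - p2)))) epowr ((2 * p1 - p2) / (p1 * p2))
           \<le> ennreal C
             * (SUP w\<in>W1. ennreal (\<Sum>i=1..m1. R1 (z1 i) w powr p2)) epowr (1 / p2)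
             * (SUP w\<in>W2. ennreal (\<Sum>j=1..m2. R2 (z2 j) w powr p2)) epowr (1 / p2)"
proof (intro allI impI)
  fix m1 m2 :: nat and z1 z2
  assume "\<forall>i\<in>{1..m1}. z1 i \<in> Z1"
  then have z1: "z1 i \<in> Z1" if "i \<in> {1..m1}" for i using that by blast
  \<comment> \<open>The condition \<open>t < 1/2\<close> is \<open>p2 < 2 * p1\<close>, and
    \<open>1 - t = p1 / p2\<close>.\<close>
  define t where "t = 1 - p1 / p2"
  have t: "0 \<le> t" "t < 1/2" using p by (auto simp: t_def field_simps)

  \<comment> \<open>The hypothesis raised to the power \<open>p1\<close>, with real upper bounds in
    place of the suprema on the right. The factor \<open>C powr p1 * M2\<close> comes first, to act
    as \<open>K\<close> in \<open>weighted_bound\<close>.\<close>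
  have real_summing: "(\<Sum>i=1..k. \<Sum>j=1..m2. S (x i) (y j) v powr p1) \<le> C powr p1 * M2 * M1"
    if v: "v \<in> V" and x: "\<And>i. i \<in> {1..k} \<Longrightarrow> x i \<in> Z1"
      and M1: "\<And>w. w \<in> W1 \<Longrightarrow> (\<Sum>i=1..k. R1 (x i) w powr p1) \<le> M1" "0 \<le> M1"
      and M2: "\<And>w. w \<in> W2 \<Longrightarrow> (\<Sum>j=1..m2. R2 (y j) w powr p1) \<le> M2" "0 \<le> M2"
    for k :: nat and x y v M1 M2
  proof -
    let ?X = "\<Sum>i=1..k. \<Sum>j=1..m2. S (x i) (y j) v powr p1"
    have X: "0 \<le> ?X" by (intro sum_nonneg) auto
    have "ennreal (?X powr (1 / p1)) = ennreal ?X epowr (1 / p1)"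
      using X by (simp add: ennpowr_ennreal)
    also have "\<dots> \<le> (SUP v\<in>V. ennreal (\<Sum>i=1..k. \<Sum>j=1..m2. S (x i) (y j) v powr p1)) epowr (1 / p1)"
      using v p by (intro epowr_mono SUP_upper) auto
    also have "\<dots> \<le> ennreal C
             * (SUP w\<in>W1. ennreal (\<Sum>i=1..k. R1 (x i) w powr p1)) epowr (1 / p1)
             * (SUP w\<in>W2. ennreal (\<Sum>j=1..m2. R2 (y j) w powr p1)) epowr (1 / p1)"
      by (rule summing) (rule x)
    also have "\<dots> \<le> ennreal C * ennreal M1 epowr (1 / p1) * ennreal M2 epowr (1 / p1)"
      using M1 M2 p by (intro mult_mono epowr_mono SUP_least ennreal_leI) auto
    also have "\<dots> = ennreal (C * M1 powr (1 / p1) * M2 powr (1 / p1))"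
      using M1(2) M2(2) C by (simp add: ennpowr_ennreal ennreal_mult)
    finally have "?X powr (1 / p1) \<le> C * M1 powr (1 / p1) * M2 powr (1 / p1)"
      using C by (simp add: ennreal_le_iff)
    then have "(?X powr (1 / p1)) powr p1 \<le> (C * M1 powr (1 / p1) * M2 powr (1 / p1)) powr p1"
      using p by (intro powr_mono2) auto
    then show ?thesis
      using p X M1(2) M2(2) C by (simp add: powr_mult powr_powr mult_ac)
  qed

  have "(SUP w\<in>W1. ennreal (\<Sum>i=1..m1. R1 (z1 i) w powr p2)) < \<infinity>"
    using p R1_finite[OF z1, of m1 "\<lambda>i. i"] unfolding epowr_less_top_iff
    by (intro SUP_sum_powr_finite_mono[where p = p1 and q = p2]) auto
  then obtain N1 where N1: "0 \<le> N1" "(SUP w\<in>W1. ennreal (\<Sum>i=1..m1. R1 (z1 i) w powr p2)) = ennreal N1"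
      "\<And>w. w \<in> W1 \<Longrightarrow> (\<Sum>i=1..m1. R1 (z1 i) w powr p2) \<le> N1"
    by (rule SUP_ennreal_finite_bound) blast
  have "(SUP w\<in>W2. ennreal (\<Sum>j=1..m2. R2 (z2 j) w powr p2)) < \<infinity>"
    using p R2_finite[of z2 m2] unfolding epowr_less_top_iff
    by (intro SUP_sum_powr_finite_mono[where p = p1 and q = p2]) auto
  then obtain N2 where N2: "0 \<le> N2" "(SUP w\<in>W2. ennreal (\<Sum>j=1..m2. R2 (z2 j) w powr p2)) = ennreal N2"
      "\<And>w. w \<in> W2 \<Longrightarrow> (\<Sum>j=1..m2. R2 (z2 j) w powr p2) \<le> N2"
    by (rule SUP_ennreal_finite_bound) blast

  \<comment> \<open>The norm bound for the bilinear form; it is the \<open>p1\<close>-th power of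
    the desired right side \<open>?E\<close>.\<close>
  define D where "D = C powr p1 * N1 powr (p1 / p2) * N2 powr (p1 / p2)"
  have weighted: "(\<Sum>i=1..m1. \<Sum>j=1..m2. a i powr t * b j powr t * S (z1 i) (z2 j) v powr p1)
      \<le> D * sum a {1..m1} powr t * sum b {1..m2} powr t"
    if v: "v \<in> V" and a: "\<And>i. i \<in> {1..m1} \<Longrightarrow> 0 \<le> a i" and b: "\<And>j. j \<in> {1..m2} \<Longrightarrow> 0 \<le> b j"
    for v a b
  proof -
    \<comment> \<open>By homogeneity, scaling by \<open>b j powr (t / p1)\<close> becomes the weight
      \<open>b j powr t\<close> after taking \<open>p1\<close>-th powers.\<close>
    define y where "y j = scale (of_real (b j powr (t / p1))) (z2 j)" for j
    define M2 where "M2 = sum b {1..m2} powr t * N2 powr (p1 / p2)"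
    have R2y: "R2 (y j) w powr p1 = b j powr t * R2 (z2 j) w powr p1" if "w \<in> W2" for j w
      using R2_homogeneous[OF _ that] R2_nonneg[OF that] p
      by (simp add: y_def powr_mult powr_powr)
    have Sy: "S x (y j) v powr p1 = b j powr t * S x (z2 j) v powr p1" if "x \<in> Z1" for j x
      using S_homogeneous[OF _ that v] S_nonneg[OF that v] p
      by (simp add: y_def powr_mult powr_powr)
    have M2: "0 \<le> M2" "(\<Sum>j=1..m2. R2 (y j) w powr p1) \<le> M2" if "w \<in> W2" for w
      using Holder_sum_weights[of "{1..m2}" b "\<lambda>j. R2 (z2 j) w" p2 N2 p1] b N2(3)[OF that] that p
      by (simp_all add: M2_def R2y t_def)
    \<comment> \<open>With \<open>y\<close> and \<open>v\<close> fixed, the inner sum is a function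
      \<open>g\<close> of the first variable, so only the first family has to be repeated. The bound
      \<open>B\<close> is Hoelder with unit weights.\<close>
    have "(\<Sum>i=1..m1. a i powr t * (\<Sum>j=1..m2. S (z1 i) (y j) v powr p1))
        \<le> C powr p1 * M2 * (sum a {1..m1} powr t * N1 powr (p1 / p2))"
    proof (rule weighted_bound[where Z = Z1 and W = W1 and f = "\<lambda>x w. R1 x w powr p1"
          and B = "(\<Sum>i=1..m1. 1) powr t * N1 powr (p1 / p2)"])
      show "(\<Sum>i=1..k. \<Sum>j=1..m2. S (x i) (y j) v powr p1) \<le> C powr p1 * M2 * M"
        if "\<And>i. i \<in> {1..k::nat} \<Longrightarrow> x i \<in> Z1"
          "\<And>w. w \<in> W1 \<Longrightarrow> (\<Sum>i=1..k. R1 (x i) w powr p1) \<le> M" "0 \<le> M" for k x M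
        using real_summing[OF v that M2(2)] M2(1) nonempty by blast
    next
      fix w assume w: "w \<in> W1"
      show "(\<Sum>i=1..m1. R1 (z1 i) w powr p1) \<le> (\<Sum>i=1..m1. 1) powr t * N1 powr (p1 / p2)"
        using Holder_sum_weights[of "{1..m1}" "\<lambda>_. 1" "\<lambda>i. R1 (z1 i) w" p2 N1 p1] N1(3)[OF w] p
        by (simp add: t_def)
      show "(\<Sum>i=1..m1. a i powr t * R1 (z1 i) w powr p1) \<le> sum a {1..m1} powr t * N1 powr (p1 / p2)"
        using Holder_sum_weights[of "{1..m1}" a "\<lambda>i. R1 (z1 i) w" p2 N1 p1] N1(3)[OF w] a p
        by (simp add: t_def)
    qed (use z1 in \<open>auto intro: sum_nonneg\<close>)
    moreover have "a i powr t * (\<Sum>j=1..m2. S (z1 i) (y j) v powr p1)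
        = (\<Sum>j=1..m2. a i powr t * b j powr t * S (z1 i) (z2 j) v powr p1)" if "i \<in> {1..m1}" for i
      using z1[OF that] by (simp add: Sy sum_distrib_left mult_ac)
    ultimately show ?thesis
      by (simp add: D_def M2_def mult_ac)
  qed

  let ?q = "p1 * p2 / (2 * p1 - p2)"
  let ?E = "C * N1 powr (1 / p2) * N2 powr (1 / p2)"
  \<comment> \<open>Here \<open>1 - 2 * t = (2 * p1 - p2) / p2\<close>, so the entries
    \<open>S powr p1\<close> raised to \<open>1 / (1 - 2 * t)\<close> carry the exponent of the
    conclusion.\<close>
  have q: "p1 * (1 / (1 - 2 * t)) = ?q" "0 < ?q"
    using p by (auto simp: t_def field_simps)
  have D: "0 \<le> D" "D = ?E powr p1"
    using p C N1(1) N2(1) by (simp_all add: D_def powr_mult powr_powr)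
  have "(\<Sum>i=1..m1. \<Sum>j=1..m2. S (z1 i) (z2 j) v powr ?q) \<le> ?E powr ?q" if v: "v \<in> V" for v
  proof -
    have "(\<Sum>i=1..m1. \<Sum>j=1..m2. S (z1 i) (z2 j) v powr ?q)
        = (\<Sum>i=1..m1. \<Sum>j=1..m2. (S (z1 i) (z2 j) v powr p1) powr (1 / (1 - 2 * t)))"
      by (simp only: powr_powr q)
    also have "\<dots> \<le> D powr (1 / (1 - 2 * t))"
      using t D(1) weighted[OF v] by (intro positive_bilinear_form_Hardy_Littlewood) auto
    also have "\<dots> = ?E powr ?q"
      by (simp only: D(2) powr_powr q)
    finally show ?thesis .
  qed
  then have "(SUP v\<in>V. ennreal (\<Sum>i=1..m1. \<Sum>j=1..m2. S (z1 i) (z2 j) v powr ?q)) \<le> ennreal (?E powr ?q)"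
    by (intro SUP_least ennreal_leI)
  then have "(SUP v\<in>V. ennreal (\<Sum>i=1..m1. \<Sum>j=1..m2. S (z1 i) (z2 j) v powr ?q)) epowr (1 / ?q)
      \<le> ennreal (?E powr ?q) epowr (1 / ?q)"
    by (rule epowr_mono) (use p in auto)
  also have "ennreal (?E powr ?q) epowr (1 / ?q) = ennreal ?E"
    using p C N1(1) N2(1) by (simp add: ennpowr_ennreal powr_powr)
  also have "ennreal ?E = ennreal C * ennreal N1 epowr (1 / p2) * ennreal N2 epowr (1 / p2)"
    using C N1(1) N2(1) by (simp add: ennpowr_ennreal ennreal_mult)
  finally show "(SUP v\<in>V. ennreal (\<Sum>i=1..m1. \<Sum>j=1..m2. S (z1 i) (z2 j) v powr ?q))
        epowr ((2 * p1 - p2) / (p1 * p2))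
      \<le> ennreal C
        * (SUP w\<in>W1. ennreal (\<Sum>i=1..m1. R1 (z1 i) w powr p2)) epowr (1 / p2)
        * (SUP w\<in>W2. ennreal (\<Sum>j=1..m2. R2 (z2 j) w powr p2)) epowr (1 / p2)"
    by (simp only: N1(2) N2(2) divide_divide_eq_right mult_1)
qed

end
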